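(* For all integers $n\ge 0$, $$\sum_{k=0}^{n}\overline{\sigma_o\mathrm{mex}}(k)\equiv 2\bigl(n-\lfloor\sqrt n\rfloor\bigr)+1\pmod 4.$$
   Context: An overpartition of a nonnegative integer $n$ is a non-increasing sequence of positive integers summing to $n$ in which the first occurrence of each distinct integer may (or may not) be overlined; $\overline{\mathcal P}(n)$ denotes the set of all overpartitions of $n$ (the only overpartition of $0$ is the empty one). For an overpartition $\lambda$, $\mathrm{mex}(\lambda)$ is the least positive integer that does not occur as a part of $\lambda$, where a value counts as occurring whether it appears overlined or non-overlined. Put $\mathrm{mex}_o(\lambda)=\mathrm{mex}(\lambda)$ if $\mathrm{mex}(\lambda)$ is odd and $\mathrm{mex}_o(\lambda)=0$ otherwise. Define $\overline{\sigma_o\mathrm{mex}}(n)=\sum_{\lambda\in\overline{\mathcal P}(n)}\mathrm{mex}_o(\lambda)$ for $n\ge 0$. *)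

theory Defs
  imports Complex_Main "HOL-Number_Theory.Cong"
begin

text \<open>
  An overpartition is a list of parts \<open>(v, b)\<close>, where \<open>v\<close> is the value of the part and
  \<open>b\<close> says whether it is overlined.
\<close>
definition overpartitions :: "nat \<Rightarrow> (nat \<times> bool) list set" where
  "overpartitions n =
     {xs. sorted_wrt (\<ge>) (map fst xs) \<and>
          (\<forall>v \<in> set (map fst xs). 0 < v) \<and>
          sum_list (map fst xs) = n \<and>
          (\<forall>i < length xs. snd (xs ! i) \<longrightarrow> (\<forall>j < i. fst (xs ! j) \<noteq> fst (xs ! i)))}"

definition mex :: "(nat \<times> bool) list \<Rightarrow> nat" where
  "mex xs = (LEAST m. 0 < m \<and> m \<notin> set (map fst xs))"

definition mex_o :: "(nat \<times> bool) list \<Rightarrow> nat" where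
  "mex_o xs = (if odd (mex xs) then mex xs else 0)"

definition sigma_o_mex :: "nat \<Rightarrow> nat" where
  "sigma_o_mex n = (\<Sum>xs \<in> overpartitions n. mex_o xs)"

text \<open>The sum above is over a finite set, so it does not take the default value 0.\<close>
lemma finite_overpartitions: "finite (overpartitions n)"
proof (rule finite_subset)
  have len: "length ys \<le> sum_list ys" if "\<forall>v \<in> set ys. 0 < v" for ys :: "nat list"
    using that by (induction ys) auto
  show "overpartitions n \<subseteq> {xs. set xs \<subseteq> {..n} \<times> UNIV \<and> length xs \<le> n}"
  proof
    fix xs assume "xs \<in> overpartitions n"
    then have pos: "\<forall>v \<in> set (map fst xs). 0 < v" and s: "sum_list (map fst xs) = n"
      by (auto simp: overpartitions_def)
    have "length xs \<le> n" using len[OF pos] s by simp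
    moreover have "fst p \<le> n" if "p \<in> set xs" for p
      using member_le_sum_list[of "fst p" "map fst xs"] that s by simp
    ultimately show "xs \<in> {xs. set xs \<subseteq> {..n} \<times> UNIV \<and> length xs \<le> n}" by auto
  qed
  show "finite {xs :: (nat \<times> bool) list. set xs \<subseteq> {..n} \<times> UNIV \<and> length xs \<le> n}"
    by (rule finite_lists_length_le) simp
qed

end

theory Submission
  imports Defs
begin

text \<open>
  The value \<^term>\<open>mex_o xs\<close> depends only on which numbers occur in \<^term>\<open>xs\<close>, and a partition with
  \<open>c\<close> distinct values can be overlined in \<open>2 ^ c\<close> ways. Modulo 4, therefore, only the partitions
  with at most one distinct value contribute. The empty partition has mex 1 and contributes 1 to
  the case of \<open>0\<close>. For \<open>k > 0\<close>, the partitions of \<open>k\<close> with exactly one distinct value \<open>v\<close> correspond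
  to the divisors \<open>v\<close> of \<open>k\<close>; such a partition has mex 1, and so contributes 2, unless \<open>v = 1\<close>, when
  its mex is 2 and it contributes 0. With \<open>d k\<close> the number of divisors of \<open>k\<close>, this gives
  \<open>2 * (d k - 1)\<close> (lemma \<open>sigma_o_mex_cong_divisors\<close>).

  Summing over \<open>k \<le> n\<close> leaves \<open>1 + 2 * (D - n)\<close>, where \<open>D\<close> is the sum of \<open>d k\<close> for
  \<open>1 \<le> k \<le> n\<close>, that is, the number of pairs of positive integers with product at most \<open>n\<close>.
  Only the parity of \<open>D\<close> matters. Swapping the two components
  is an involution on these pairs whose fixed points are the \<open>(a, a)\<close> with \<open>a * a \<le> n\<close>, so \<open>D\<close> has
  the parity of \<open>\<lfloor>sqrt n\<rfloor>\<close> (lemma \<open>parity_sum_divisor_count\<close>).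
\<close>

section \<open>Forgetting the overlines\<close>

definition partitions :: "nat \<Rightarrow> nat list set" where
  "partitions n = {ys. sorted_wrt (\<ge>) ys \<and> (\<forall>v \<in> set ys. 0 < v) \<and> sum_list ys = n}"

definition overlinings :: "nat list \<Rightarrow> (nat \<times> bool) list set" where
  "overlinings ys =
     {xs. map fst xs = ys \<and>
          (\<forall>i < length xs. snd (xs ! i) \<longrightarrow> (\<forall>j < i. fst (xs ! j) \<noteq> fst (xs ! i)))}"

text \<open>
  As \<^term>\<open>mex_o\<close> takes overpartitions, this representative of its fibre stands for a partition.
\<close>
definition plain :: "nat list \<Rightarrow> (nat \<times> bool) list" where
  "plain ys = map (\<lambda>y. (y, False)) ys"

lemma map_fst_plain [simp]: "map fst (plain ys) = ys"
  by (induction ys) (auto simp: plain_def)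

text \<open>
  The last entry of a list may be overlined exactly when its value is new, and whether an earlier
  entry may be overlined does not depend on the last one. Building a list from the left thus offers
  two choices at each new value and one choice at each repeated value.
\<close>
lemma overlinings_snoc:
  "overlinings (ys @ [y]) =
     (\<lambda>(xs, b). xs @ [(y, b)]) ` (overlinings ys \<times> (if y \<in> set ys then {False} else UNIV))"
    (is "?L = ?f ` ?R")
proof
  have len: "length xs = length ys" if "map fst xs = ys" for xs :: "(nat \<times> bool) list"
    using that by auto
  show "?L \<subseteq> ?f ` ?R"
  proof
    fix zs assume zs: "zs \<in> ?L"
    then have "map fst zs = ys @ [y]" by (simp add: overlinings_def)
    then obtain xs b where zs_eq: "zs = xs @ [(y, b)]" and xs: "map fst xs = ys"
      by (auto simp: map_eq_append_conv)
    have cond: "\<forall>j < i. fst (zs ! j) \<noteq> fst (zs ! i)" if "i < length zs" "snd (zs ! i)" for i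
      using zs that unfolding overlinings_def by blast
    have "xs \<in> overlinings ys"
      unfolding overlinings_def
    proof (intro CollectI conjI allI impI xs)
      fix i j assume i: "i < length xs" "snd (xs ! i)" and "j < i"
      then show "fst (xs ! j) \<noteq> fst (xs ! i)"
        using cond[of i] by (auto simp: zs_eq nth_append)
    qed
    moreover have "\<not> b" if "y \<in> set ys"
    proof
      assume b
      from that xs obtain j where "j < length xs" "fst (xs ! j) = y"
        by (metis in_set_conv_nth length_map nth_map)
      then show False using cond[of "length xs"] \<open>b\<close> by (auto simp: zs_eq nth_append)
    qed
    ultimately show "zs \<in> ?f ` ?R" by (force simp: zs_eq)
  qed
  show "?f ` ?R \<subseteq> ?L"
  proof
    fix zs assume "zs \<in> ?f ` ?R"
    then obtain xs b where zs_eq: "zs = xs @ [(y, b)]" and xs: "xs \<in> overlinings ys"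
      and b: "b \<Longrightarrow> y \<notin> set ys"
      by (auto split: if_splits)
    have map: "map fst xs = ys" using xs by (simp add: overlinings_def)
    have new: "fst (xs ! j) \<noteq> y" if b "j < length xs" for j
      using b[OF \<open>b\<close>] map that by (metis length_map nth_map nth_mem)
    have old: "fst (xs ! j) \<noteq> fst (xs ! i)" if "i < length xs" "snd (xs ! i)" "j < i" for i j
      using xs that unfolding overlinings_def by blast
    show "zs \<in> ?L"
      unfolding overlinings_def
    proof (intro CollectI conjI allI impI)
      show "map fst zs = ys @ [y]" using map by (simp add: zs_eq)
    next
      fix i j assume "i < length zs" "snd (zs ! i)" "j < i"
      then show "fst (zs ! j) \<noteq> fst (zs ! i)"
        using new old by (cases "i < length xs") (auto simp: zs_eq nth_append not_less less_Suc_eq)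
    qed
  qed
qed

lemma card_overlinings: "card (overlinings ys) = 2 ^ card (set ys)"
proof (induction ys rule: rev_induct)
  case Nil
  have "overlinings [] = {[]}" by (auto simp: overlinings_def)
  then show ?case by simp
next
  case (snoc y ys)
  have "inj_on (\<lambda>(xs, b). xs @ [(y, b)]) A" for A :: "((nat \<times> bool) list \<times> bool) set"
    by (auto simp: inj_on_def)
  then show ?case
    by (simp add: overlinings_snoc card_image card_cartesian_product snoc insert_absorb)
qed

lemma partitions_eq_image: "partitions n = map fst ` overpartitions n"
proof
  show "partitions n \<subseteq> map fst ` overpartitions n"
  proof
    fix ys assume "ys \<in> partitions n"
    then have "plain ys \<in> overpartitions n"
      by (auto simp: partitions_def overpartitions_def) (auto simp: plain_def)
    then show "ys \<in> map fst ` overpartitions n"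
      by (metis image_eqI map_fst_plain)
  qed
qed (auto simp: partitions_def overpartitions_def)

lemma finite_partitions: "finite (partitions n)"
  by (simp add: partitions_eq_image finite_overpartitions)

lemma mex_o_cong: "map fst xs = map fst zs \<Longrightarrow> mex_o xs = mex_o zs"
  by (simp add: mex_o_def mex_def flip: set_map)

lemma sigma_o_mex_eq_sum_partitions:
  "sigma_o_mex n = (\<Sum>ys \<in> partitions n. 2 ^ card (set ys) * mex_o (plain ys))"
proof -
  have "(\<Sum>xs \<in> {xs \<in> overpartitions n. map fst xs = ys}. mex_o xs) =
          2 ^ card (set ys) * mex_o (plain ys)" if "ys \<in> partitions n" for ys
  proof -
    have "{xs \<in> overpartitions n. map fst xs = ys} = overlinings ys"
      using that by (fastforce simp: partitions_def overpartitions_def overlinings_def)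
    moreover have "mex_o xs = mex_o (plain ys)" if "xs \<in> overlinings ys" for xs
      using that by (intro mex_o_cong) (simp add: overlinings_def)
    ultimately show ?thesis by (simp add: card_overlinings)
  qed
  then show ?thesis
    by (simp add: sigma_o_mex_def partitions_eq_image
          sum.image_gen[OF finite_overpartitions, of _ _ "map fst"])
qed

section \<open>Reduction modulo 4\<close>

lemma mex_o_eq_1: "1 \<notin> set (map fst xs) \<Longrightarrow> mex_o xs = 1"
proof -
  assume "1 \<notin> set (map fst xs)"
  then have "mex xs = 1" unfolding mex_def by (intro Least_equality) auto
  then show ?thesis by (simp add: mex_o_def)
qed

lemma mex_o_all_ones:
  assumes "set (map fst xs) = {1}"
  shows "mex_o xs = 0"
proof -
  have "mex xs = 2" unfolding mex_def assms
    by (intro Least_equality) auto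
  then show ?thesis by (simp add: mex_o_def)
qed

lemma sigma_o_mex_0: "sigma_o_mex 0 = 1"
proof -
  have "ys = []" if "ys \<in> partitions 0" for ys
    using that by (cases ys) (auto simp: partitions_def)
  moreover have "[] \<in> partitions 0" by (simp add: partitions_def)
  ultimately have "partitions 0 = {[]}" by blast
  then show ?thesis by (simp add: sigma_o_mex_eq_sum_partitions mex_o_eq_1 plain_def)
qed

lemma partitions_with_one_value:
  assumes "n > 0"
  shows "{ys \<in> partitions n. card (set ys) = 1} = (\<lambda>v. replicate (n div v) v) ` {v. v dvd n}"
    (is "?L = ?f ` ?R")
proof
  show "?L \<subseteq> ?f ` ?R"
  proof
    fix ys assume ys: "ys \<in> ?L"
    then obtain v where v: "set ys = {v}" by (auto simp: card_1_singleton_iff)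
    then have rep: "ys = replicate (length ys) v"
      by (intro replicate_eqI) auto
    have "sum_list ys = n" "v > 0" using ys v by (auto simp: partitions_def)
    moreover have "sum_list ys = length ys * v"
      by (subst rep) (simp add: sum_list_replicate)
    ultimately have len: "length ys = n div v" and "v dvd n" by auto
    from rep have "ys = ?f v" unfolding len .
    with \<open>v dvd n\<close> show "ys \<in> ?f ` ?R" by blast
  qed
  show "?f ` ?R \<subseteq> ?L"
  proof
    fix ys assume "ys \<in> ?f ` ?R"
    then obtain v where v: "v dvd n" "ys = replicate (n div v) v" by auto
    with assms have "v > 0" "n div v > 0"
      by (auto simp: div_greater_zero_iff dvd_imp_le intro: dvd_pos_nat)
    with v show "ys \<in> ?L"
      by (simp add: partitions_def sum_list_replicate sorted_wrt_iff_nth_less)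
  qed
qed

text \<open>
  A partition with \<open>c \<ge> 2\<close> distinct values enters with the weight \<open>2 ^ c\<close>, which 4 divides, so the
  partitions counted by the divisors remain. The divisor 1 drops out because a partition into ones
  has the even mex 2.
\<close>
lemma sigma_o_mex_cong_divisors:
  assumes "n > 0"
  shows "[int (sigma_o_mex n) = 2 * (int (card {v. v dvd n}) - 1)] (mod 4)"
proof -
  let ?f = "\<lambda>v. replicate (n div v) v"
  let ?w = "\<lambda>ys. 2 ^ card (set ys) * mex_o (plain ys)"
  have fin: "finite {v. v dvd n}" using assms by simp
  have pos: "v > 0" "n div v > 0" if "v dvd n" for v
    using that assms by (auto simp: div_greater_zero_iff dvd_imp_le intro: dvd_pos_nat)
  have inj: "inj_on ?f {v. v dvd n}"
  proof (rule inj_onI)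
    fix v w assume "v \<in> {v. v dvd n}" "w \<in> {v. v dvd n}" "?f v = ?f w"
    then show "v = w" using pos(2) by (metis mem_Collect_eq replicate_eq_replicate neq0_conv)
  qed
  have "[sigma_o_mex n = (\<Sum>ys \<in> partitions n. if card (set ys) = 1 then ?w ys else 0)] (mod 4)"
    unfolding sigma_o_mex_eq_sum_partitions
  proof (rule cong_sum)
    fix ys assume "ys \<in> partitions n"
    then have "ys \<noteq> []" using assms by (auto simp: partitions_def)
    then have "card (set ys) > 0" by (simp add: card_gt_0_iff)
    then consider "card (set ys) = 1" | "2 \<le> card (set ys)" by linarith
    then show "[?w ys = (if card (set ys) = 1 then ?w ys else 0)] (mod 4)"
    proof cases
      case 2
      have "(2::nat) ^ 2 dvd 2 ^ card (set ys)" using 2 by (rule le_imp_power_dvd)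
      with 2 show ?thesis by (simp add: cong_0_iff)
    qed simp
  qed
  also have "(\<Sum>ys \<in> partitions n. if card (set ys) = 1 then ?w ys else 0) =
             (\<Sum>ys \<in> ?f ` {v. v dvd n}. ?w ys)"
    unfolding partitions_with_one_value[OF assms, symmetric]
    by (rule sum.inter_filter[symmetric, OF finite_partitions])
  also have "\<dots> = (\<Sum>v | v dvd n. ?w (?f v))"
    using inj by (simp add: sum.reindex)
  also have "\<dots> = (\<Sum>v | v dvd n. if v = 1 then 0 else 2)"
  proof (rule sum.cong[OF refl])
    fix v assume "v \<in> {v. v dvd n}"
    then have "set (?f v) = {v}" using pos(2) by auto
    then show "?w (?f v) = (if v = 1 then 0 else 2)"
      using mex_o_eq_1[of "plain (?f v)"] mex_o_all_ones[of "plain (?f v)"] by auto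
  qed
  also have "\<dots> = 2 * card ({v. v dvd n} - {1})"
    using fin by (simp add: sum.remove[of _ 1])
  also have "\<dots> = 2 * (card {v. v dvd n} - 1)" by (simp add: card_Diff_singleton)
  finally have "[int (sigma_o_mex n) = int (2 * (card {v. v dvd n} - 1))] (mod 4)"
    by (simp flip: cong_int_iff)
  moreover have "card {v. v dvd n} > 0" using fin by (auto simp: card_gt_0_iff)
  ultimately show ?thesis by (simp add: of_nat_diff)
qed

section \<open>Parity of the divisor sum\<close>

lemma sum_divisor_count_eq_card_pairs:
  "(\<Sum>k=1..n. card {v. v dvd k}) = card {(a, b). 0 < a \<and> 0 < b \<and> a * b \<le> (n::nat)}"
proof -
  have "(\<Sum>k=1..n. card {v. v dvd k}) = card (SIGMA k:{1..n}. {v. v dvd k})"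
    by (subst card_SigmaI) auto
  also have "\<dots> = card {(a, b). 0 < a \<and> 0 < b \<and> a * b \<le> n}"
    by (rule bij_betw_same_card[of "\<lambda>(k, v). (v, k div v)"],
        rule bij_betw_byWitness[where f' = "\<lambda>(a, b). (a * b, a)"])
       (auto simp: div_greater_zero_iff dvd_imp_le intro: dvd_pos_nat)
  finally show ?thesis .
qed

text \<open>
  Off the diagonal, swapping matches the pairs with \<open>a < b\<close> to those with \<open>b < a\<close>; the parity is
  that of the number of diagonal pairs.
\<close>
lemma parity_sum_divisor_count:
  "[int (\<Sum>k=1..n. card {v. v dvd k}) = \<lfloor>sqrt (real n)\<rfloor>] (mod 2)"
proof -
  let ?P = "\<lambda>R. {(a, b). 0 < a \<and> 0 < b \<and> a * b \<le> n \<and> R a b}"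
  have "{(a, b). 0 < a \<and> 0 < b \<and> a * b \<le> n} \<subseteq> {..n} \<times> {..n}"
  proof clarsimp
    fix a b :: nat assume "0 < a" "0 < b" "a * b \<le> n"
    moreover from this have "a * 1 \<le> a * b" "1 * b \<le> a * b" by (intro mult_le_mono; simp)+
    ultimately show "a \<le> n \<and> b \<le> n" by linarith
  qed
  then have fin: "finite {(a, b). 0 < a \<and> 0 < b \<and> a * b \<le> n}"
    by (rule finite_subset) simp
  have fin_P: "finite (?P R)" for R by (rule finite_subset[OF _ fin]) auto
  define m where "m = nat \<lfloor>sqrt (real n)\<rfloor>"
  have le_m: "a \<le> m \<longleftrightarrow> a * a \<le> n" for a
  proof -
    have "a \<le> m \<longleftrightarrow> real a \<le> sqrt (real n)"
      by (simp add: m_def le_nat_iff le_floor_iff)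
    also have "\<dots> \<longleftrightarrow> real (a * a) \<le> real n"
      using real_le_rsqrt[of "real a" "real n"] sqrt_ge_absD[of "real a" "real n"]
      by (auto simp: power2_eq_square)
    finally show ?thesis by (simp only: of_nat_le_iff)
  qed
  have "{(a, b). 0 < a \<and> 0 < b \<and> a * b \<le> n} = (?P (<) \<union> ?P (>)) \<union> ?P (=)" by auto
  moreover have "card ((?P (<) \<union> ?P (>)) \<union> ?P (=)) = card (?P (<) \<union> ?P (>)) + card (?P (=))"
    by (rule card_Un_disjoint) (use fin_P in auto)
  moreover have "card (?P (<) \<union> ?P (>)) = card (?P (<)) + card (?P (>))"
    by (rule card_Un_disjoint) (use fin_P in auto)
  moreover have "card (?P (>)) = card (?P (<))"
    by (rule bij_betw_same_card[of prod.swap], rule bij_betw_byWitness[where f' = prod.swap])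
       (auto simp: mult.commute)
  moreover have "card (?P (=)) = card {1..m}"
    by (rule bij_betw_same_card[of fst], rule bij_betw_byWitness[where f' = "\<lambda>a. (a, a)"])
       (auto simp: le_m)
  ultimately have "(\<Sum>k=1..n. card {v. v dvd k}) = 2 * card (?P (<)) + m"
    by (simp only: sum_divisor_count_eq_card_pairs card_atLeastAtMost)
  then have "int (\<Sum>k=1..n. card {v. v dvd k}) = 2 * int (card (?P (<))) + \<lfloor>sqrt (real n)\<rfloor>"
    by (simp add: m_def)
  then show ?thesis by (simp add: cong_def)
qed

theorem theorem1p6:
  fixes n :: nat
  shows "[int (\<Sum>k=0..n. sigma_o_mex k) = 2 * (int n - \<lfloor>sqrt (real n)\<rfloor>) + 1] (mod 4)"
proof -
  let ?D = "\<Sum>k=1..n. card {v. v dvd k}"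
  have "[(\<Sum>k=1..n. int (sigma_o_mex k)) = (\<Sum>k=1..n. 2 * (int (card {v. v dvd k}) - 1))] (mod 4)"
    by (rule cong_sum, rule sigma_o_mex_cong_divisors) simp
  also have "(\<Sum>k=1..n. 2 * (int (card {v. v dvd k}) - 1)) = 2 * int ?D - 2 * int n"
    by (simp add: sum_subtractf sum_distrib_left algebra_simps)
  finally have "4 dvd (\<Sum>k=1..n. int (sigma_o_mex k)) - (2 * int ?D - 2 * int n)"
    by (simp only: cong_iff_dvd_diff)
  then obtain s where s: "(\<Sum>k=1..n. int (sigma_o_mex k)) = 2 * int ?D - 2 * int n + 4 * s"
    by (auto simp: dvd_def algebra_simps)
  obtain t where t: "int ?D = \<lfloor>sqrt (real n)\<rfloor> + 2 * t"
    using parity_sum_divisor_count[of n] by (auto simp: cong_iff_dvd_diff dvd_def algebra_simps)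
  have "int (\<Sum>k=0..n. sigma_o_mex k) = 1 + (\<Sum>k=1..n. int (sigma_o_mex k))"
    by (simp add: sum.atLeast_Suc_atMost sigma_o_mex_0)
  \<comment> \<open>The sign of \<open>n - \<lfloor>sqrt n\<rfloor>\<close> is reversed here, which is harmless modulo 4 in front of the
      factor 2.\<close>
  also have "\<dots> = 2 * (int n - \<lfloor>sqrt (real n)\<rfloor>) + 1 + 4 * (s + t + \<lfloor>sqrt (real n)\<rfloor> - int n)"
    unfolding s t by (simp add: algebra_simps)
  finally show ?thesis by (simp add: cong_iff_dvd_diff)
qed

end
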